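(* For every integer $n\geq 6$, the complement $C_n^c$ of the cycle $C_n$ is an extremal $\left(n-3\,\middle|\,\left\lceil n/2\right\rceil\right)$-graph; that is, $C_n^c$ is $(n-3)$-regular with chromatic number $\lceil n/2\rceil$, and every $(n-3)$-regular graph with chromatic number $\lceil n/2\rceil$ has at least $n$ vertices.
   Context: An $(r|\chi)$-graph is a simple finite $r$-regular graph with chromatic number $\chi$; it is extremal if it has the minimum possible order among all $(r|\chi)$-graphs. *)

theory Defs
  imports Complex_Main "Graph_Theory.Pair_Digraph"
begin

text \<open>
  Finite simple graphs are the symmetric loop-free digraphs without parallel arcs, i.e. those
  satisfying \<^term>\<open>pair_graph\<close>: an undirected edge is a pair of opposite arcs, so the degree
  of a vertex is its out-degree.
\<close>

definition graph_order :: "'a pair_pre_digraph \<Rightarrow> nat" where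
  "graph_order G = card (pverts G)"

definition regular_graph :: "nat \<Rightarrow> 'a pair_pre_digraph \<Rightarrow> bool" where
  "regular_graph r G \<longleftrightarrow> (\<forall>v \<in> pverts G. out_degree (with_proj G) v = r)"

definition proper_coloring :: "'a pair_pre_digraph \<Rightarrow> nat \<Rightarrow> ('a \<Rightarrow> nat) \<Rightarrow> bool" where
  "proper_coloring G k c \<longleftrightarrow>
     (\<forall>v \<in> pverts G. c v < k) \<and> (\<forall>(u, v) \<in> parcs G. c u \<noteq> c v)"

definition chromatic_number :: "'a pair_pre_digraph \<Rightarrow> nat" where
  "chromatic_number G = (LEAST k. \<exists>c. proper_coloring G k c)"

definition r_chi_graph :: "nat \<Rightarrow> nat \<Rightarrow> 'a pair_pre_digraph \<Rightarrow> bool" where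
  "r_chi_graph r k G \<longleftrightarrow> pair_graph G \<and> regular_graph r G \<and> chromatic_number G = k"

text \<open>
  A definition cannot quantify over vertex types. Every finite graph is isomorphic to one with
  vertices in \<^typ>\<open>nat\<close>, so it suffices to compare with those.
\<close>

definition extremal_r_chi_graph :: "nat \<Rightarrow> nat \<Rightarrow> 'a pair_pre_digraph \<Rightarrow> bool" where
  "extremal_r_chi_graph r k G \<longleftrightarrow> r_chi_graph r k G \<and>
     (\<forall>H :: nat pair_pre_digraph. r_chi_graph r k H \<longrightarrow> graph_order G \<le> graph_order H)"

definition graph_complement :: "'a pair_pre_digraph \<Rightarrow> 'a pair_pre_digraph" where
  "graph_complement G = \<lparr> pverts = pverts G,
     parcs = {(u, v). u \<in> pverts G \<and> v \<in> pverts G \<and> u \<noteq> v \<and> (u, v) \<notin> parcs G} \<rparr>"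

text \<open>The cycle on \<open>0, \<dots>, n - 1\<close>; meaningful for \<open>n \<ge> 3\<close>.\<close>

definition cycle_graph :: "nat \<Rightarrow> nat pair_pre_digraph" where
  "cycle_graph n = \<lparr> pverts = {..<n},
     parcs = {(i, j). i < n \<and> j < n \<and> (j = Suc i mod n \<or> i = Suc j mod n)} \<rparr>"

end

theory Submission
  imports Defs
begin

text \<open>
  In an \<open>(n - 3)\<close>-regular graph of order \<open>m\<close> every vertex has exactly \<open>m - (n - 3)\<close> non-neighbours,
  itself included. So \<open>m \<ge> n - 2\<close>. If \<open>m = n - 2\<close>, the graph is complete and needs
  \<open>n - 2 > \<lceil>n/2\<rceil>\<close> colours. If \<open>m = n - 1\<close>, the complement is a perfect matching, whose edges are the
  classes of a colouring with \<open>(n - 1)/2 < \<lceil>n/2\<rceil>\<close> colours. For the complement of the cycle itself,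
  colour classes are cliques of the triangle-free graph \<open>C\<^sub>n\<close>, so they have at most two vertices, and
  \<open>v div 2\<close> is an optimal colouring.
\<close>

section \<open>Non-neighbours and colourings of a finite graph\<close>

definition non_neighbours :: "'a pair_pre_digraph \<Rightarrow> 'a \<Rightarrow> 'a set" where
  "non_neighbours G v = {w \<in> pverts G. (v, w) \<notin> parcs G}"

lemma out_degree_with_proj:
  "out_degree (with_proj G) v = card {w. (v, w) \<in> parcs G}"
proof -
  have "out_arcs (with_proj G) v = Pair v ` {w. (v, w) \<in> parcs G}"
    by (auto simp: out_arcs_def)
  then show ?thesis
    by (simp add: out_degree_def card_image inj_on_def)
qed

context pair_graph
begin

lemma sym_parcs: "(u, v) \<in> parcs G \<Longrightarrow> (v, u) \<in> parcs G"
  using arcs_symmetric by simp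

lemma out_degree_add_card_non_neighbours:
  assumes "v \<in> pverts G"
  shows "out_degree (with_proj G) v + card (non_neighbours G v) = card (pverts G)"
proof -
  have "pverts G = {w. (v, w) \<in> parcs G} \<union> non_neighbours G v"
    using in_arcsD2 by (auto simp: non_neighbours_def)
  moreover have "finite {w. (v, w) \<in> parcs G}"
    by (rule finite_subset[of _ "pverts G"]) (use in_arcsD2 in auto)
  moreover have "finite (non_neighbours G v)"
    by (simp add: non_neighbours_def)
  moreover have "{w. (v, w) \<in> parcs G} \<inter> non_neighbours G v = {}"
    by (auto simp: non_neighbours_def)
  ultimately show ?thesis
    by (metis card_Un_disjoint out_degree_with_proj)
qed

lemma self_in_non_neighbours: "v \<in> pverts G \<Longrightarrow> v \<in> non_neighbours G v"
  using no_loops' by (auto simp: non_neighbours_def)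

text \<open>Colours may have any type: a bijection renumbers the finitely many values of
  \<open>g\<close> as an initial segment of the naturals. This allows sets of vertices as colours
  below.\<close>

lemma proper_coloring_of_separating_map:
  assumes "\<And>u v. (u, v) \<in> parcs G \<Longrightarrow> g u \<noteq> g v"
  shows "\<exists>c. proper_coloring G (card (g ` pverts G)) c"
proof -
  obtain h where h: "bij_betw h (g ` pverts G) {0..<card (g ` pverts G)}"
    using ex_bij_betw_finite_nat[of "g ` pverts G"] by auto
  have "h (g v) < card (g ` pverts G)" if "v \<in> pverts G" for v
    using h that by (fastforce simp: bij_betw_def)
  moreover have "h (g u) \<noteq> h (g v)" if "(u, v) \<in> parcs G" for u v
    using h assms[OF that] in_arcsD1[OF that] in_arcsD2[OF that]
    by (auto simp: bij_betw_def inj_on_def)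
  ultimately have "proper_coloring G (card (g ` pverts G)) (h \<circ> g)"
    by (auto simp: proper_coloring_def)
  then show ?thesis by blast
qed

text \<open>Giving every vertex its own colour shows that \<open>LEAST\<close> ranges over a
  nonempty set, so the minimum is attained.\<close>

lemma chromatic_number_coloring: "\<exists>c. proper_coloring G (chromatic_number G) c"
proof -
  have "\<exists>c. proper_coloring G (card ((\<lambda>v. v) ` pverts G)) c"
    by (rule proper_coloring_of_separating_map) (use no_loops' in auto)
  then show ?thesis
    unfolding chromatic_number_def by (rule LeastI)
qed

lemma chromatic_number_complete:
  assumes "\<And>v. v \<in> pverts G \<Longrightarrow> card (non_neighbours G v) = 1"
  shows "card (pverts G) \<le> chromatic_number G"
proof -
  obtain c where c: "proper_coloring G (chromatic_number G) c"
    using chromatic_number_coloring by blast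
  have "inj_on c (pverts G)"
  proof (rule inj_onI, rule ccontr)
    fix u v assume uv: "u \<in> pverts G" "v \<in> pverts G" "c u = c v" "u \<noteq> v"
    then have "(u, v) \<notin> parcs G"
      using c by (auto simp: proper_coloring_def)
    then have "v \<in> non_neighbours G u"
      using uv by (simp add: non_neighbours_def)
    moreover have "u \<in> non_neighbours G u"
      using uv by (simp add: self_in_non_neighbours)
    ultimately show False
      using assms[OF uv(1)] uv(4) by (auto simp: card_1_singleton_iff)
  qed
  moreover have "c ` pverts G \<subseteq> {..<chromatic_number G}"
    using c by (auto simp: proper_coloring_def)
  ultimately show ?thesis
    using card_inj_on_le[of c "pverts G" "{..<chromatic_number G}"] by simp
qed

text \<open>The sets \<open>non_neighbours G v\<close> are pairs that partition the vertices. Each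
  pair is independent, so the pairs themselves serve as colours.\<close>

lemma chromatic_number_cocktail_party:
  assumes two: "\<And>v. v \<in> pverts G \<Longrightarrow> card (non_neighbours G v) = 2"
  shows "2 * chromatic_number G \<le> card (pverts G)"
proof -
  let ?S = "non_neighbours G"
  \<comment> \<open>For \<open>u \<noteq> v\<close>, symmetry also gives
    \<open>u \<in> ?S v\<close>, so both two-element sets equal \<open>{u, v}\<close>.\<close>
  have eq: "?S u = ?S v" if "u \<in> pverts G" "v \<in> ?S u" for u v
  proof (cases "u = v")
    case False
    have v: "v \<in> pverts G"
      using that by (simp add: non_neighbours_def)
    have u: "u \<in> ?S v"
      using that sym_parcs by (auto simp: non_neighbours_def)
    have fin: "finite (?S w)" for w
      by (simp add: non_neighbours_def)
    have "{u, v} = ?S u"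
      by (rule card_subset_eq) (use that False fin two self_in_non_neighbours in auto)
    moreover have "{u, v} = ?S v"
      by (rule card_subset_eq) (use u v False fin two self_in_non_neighbours in auto)
    ultimately show ?thesis by simp
  qed simp
  have union: "\<Union> (?S ` pverts G) = pverts G"
    using self_in_non_neighbours by (fastforce simp: non_neighbours_def)
  have "2 * card (?S ` pverts G) = card (\<Union> (?S ` pverts G))"
  proof (rule card_partition)
    fix A B assume "A \<in> ?S ` pverts G" "B \<in> ?S ` pverts G" "A \<noteq> B"
    then show "A \<inter> B = {}"
      using eq by blast
  qed (use two union in auto)
  moreover have "\<exists>c. proper_coloring G (card (?S ` pverts G)) c"
  proof (rule proper_coloring_of_separating_map)
    fix u v assume "(u, v) \<in> parcs G"
    then have "v \<in> ?S v" "v \<notin> ?S u"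
      using in_arcsD2 self_in_non_neighbours by (auto simp: non_neighbours_def)
    then show "?S u \<noteq> ?S v" by blast
  qed
  then have "chromatic_number G \<le> card (?S ` pverts G)"
    unfolding chromatic_number_def by (rule Least_le)
  ultimately show ?thesis
    using union by simp
qed

end

section \<open>Lower bound on the order\<close>

lemma nat_ceiling_half: "nat \<lceil>real n / 2\<rceil> = (n + 1) div 2"
  by linarith

lemma graph_order_lower_bound:
  fixes H :: "'a pair_pre_digraph"
  assumes n: "n \<ge> 6" and H: "r_chi_graph (n - 3) ((n + 1) div 2) H"
  shows "n \<le> graph_order H"
proof (rule ccontr)
  assume small: "\<not> n \<le> graph_order H"
  interpret pair_graph H
    using H by (simp add: r_chi_graph_def)
  have chi: "chromatic_number H = (n + 1) div 2"
    using H by (simp add: r_chi_graph_def)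
  have card: "n - 3 + card (non_neighbours H v) = card (pverts H)" if "v \<in> pverts H" for v
    using H out_degree_add_card_non_neighbours[OF that] that
    by (simp add: r_chi_graph_def regular_graph_def)
  \<comment> \<open>The empty graph is vacuously regular of every degree, so only its chromatic
    number excludes it.\<close>
  have "pverts H \<noteq> {}"
  proof
    assume "pverts H = {}"
    then have "chromatic_number H \<le> 0"
      using chromatic_number_cocktail_party by simp
    then show False
      using chi n by simp
  qed
  then obtain v where v: "v \<in> pverts H" by blast
  have "card (non_neighbours H v) > 0"
    using self_in_non_neighbours[OF v] by (auto simp: card_gt_0_iff non_neighbours_def)
  then consider "card (pverts H) = n - 2" | "card (pverts H) = n - 1"
    using card[OF v] small n by (fastforce simp: graph_order_def)
  then show False
  proof cases
    case 1
    then have "card (non_neighbours H w) = 1" if "w \<in> pverts H" for w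
      using card[OF that] n by linarith
    then have "card (pverts H) \<le> chromatic_number H"
      by (rule chromatic_number_complete)
    \<comment> \<open>At \<open>n = 5\<close> both sides would be 3; from \<open>n = 6\<close> on,
      \<open>n - 2\<close> exceeds \<open>(n + 1) div 2\<close>.\<close>
    then show False
      using 1 chi n by linarith
  next
    case 2
    then have "card (non_neighbours H w) = 2" if "w \<in> pverts H" for w
      using card[OF that] n by linarith
    then have "2 * chromatic_number H \<le> card (pverts H)"
      by (rule chromatic_number_cocktail_party)
    then show False
      using 2 chi n by linarith
  qed
qed

section \<open>The cycle and its complement\<close>

lemma pverts_complement_cycle: "pverts (graph_complement (cycle_graph n)) = {..<n}"
  by (simp add: graph_complement_def cycle_graph_def)

lemma parcs_complement_cycle_iff:
  "(u, v) \<in> parcs (graph_complement (cycle_graph n)) \<longleftrightarrow>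
    u < n \<and> v < n \<and> u \<noteq> v \<and> (u, v) \<notin> parcs (cycle_graph n)"
  by (simp add: graph_complement_def) (simp add: cycle_graph_def)

text \<open>Ordering the endpoints removes the modulus: only the edge closing the cycle, between
  \<open>0\<close> and \<open>n - 1\<close>, is not a successor step.\<close>

lemma cycle_adjacent_iff:
  assumes "i < j" "j < n"
  shows "(i, j) \<in> parcs (cycle_graph n) \<longleftrightarrow> j = Suc i \<or> i = 0 \<and> j = n - 1"
  using assms by (cases "Suc j = n") (auto simp: cycle_graph_def)

text \<open>Since \<open>0 < j < n - 1\<close>, the edges at \<open>j\<close> are successor steps,
  so \<open>k = i + 2\<close>. Then the edge from \<open>i\<close> to \<open>k\<close> must close
  the cycle, which forces \<open>n = 3\<close>.\<close>

lemma cycle_graph_triangle_free: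
  assumes "n \<ge> 4" "i < j" "j < k" "k < n"
    and "(i, j) \<in> parcs (cycle_graph n)" "(j, k) \<in> parcs (cycle_graph n)"
    and "(i, k) \<in> parcs (cycle_graph n)"
  shows False
  using assms cycle_adjacent_iff[of i j n] cycle_adjacent_iff[of j k n] cycle_adjacent_iff[of i k n]
  by auto

lemma cycle_graph_clique_card:
  fixes A :: "nat set"
  assumes n: "n \<ge> 4" and sub: "A \<subseteq> {..<n}"
    and clique: "\<And>i j. i \<in> A \<Longrightarrow> j \<in> A \<Longrightarrow> i \<noteq> j \<Longrightarrow> (i, j) \<in> parcs (cycle_graph n)"
  shows "card A \<le> 2"
proof (rule ccontr)
  assume "\<not> card A \<le> 2"
  then have "3 \<le> card A" by simp
  then obtain T where T: "T \<subseteq> A" "card T = 3" "finite T"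
    by (rule obtain_subset_with_card_n)
  then obtain x y z where "T = {x, y, z}" "x \<noteq> y" "y \<noteq> z" "x \<noteq> z"
    by (metis card_3_iff)
  then obtain i j k where "i \<in> A" "j \<in> A" "k \<in> A" "i < j" "j < k"
    using T(1) by (metis insert_subset linorder_neqE_nat)
  then show False
    using cycle_graph_triangle_free[OF n, of i j k] clique sub by (auto simp: subset_iff)
qed

lemma cycle_graph_neighbours:
  assumes "n \<ge> 3" "v < n"
  shows "{w. (v, w) \<in> parcs (cycle_graph n)} =
    {if Suc v = n then 0 else Suc v, if v = 0 then n - 1 else v - 1}"
proof -
  \<comment> \<open>Below \<open>n\<close> the modulus acts only at \<open>w = n - 1\<close>, so a
    case distinction can replace it.\<close>
  have "Suc w mod n = (if Suc w = n then 0 else Suc w)" if "w < n" for w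
    using that by simp
  then have "{w. (v, w) \<in> parcs (cycle_graph n)} =
      {w. w < n \<and> (w = (if Suc v = n then 0 else Suc v) \<or> v = (if Suc w = n then 0 else Suc w))}"
    using assms(2) by (simp add: cycle_graph_def cong: conj_cong)
  also have "\<dots> = {if Suc v = n then 0 else Suc v, if v = 0 then n - 1 else v - 1}"
    using assms by (auto split: if_splits)
  finally show ?thesis .
qed

lemma pair_graph_complement_cycle: "pair_graph (graph_complement (cycle_graph n))"
  by unfold_locales
    (auto simp: graph_complement_def cycle_graph_def symmetric_def
      intro!: symI intro: finite_subset[of _ "{..<n} \<times> {..<n}"])

lemma regular_complement_cycle:
  assumes "n \<ge> 3"
  shows "regular_graph (n - 3) (graph_complement (cycle_graph n))"
proof -
  have "card {w. (v, w) \<in> parcs (graph_complement (cycle_graph n))} = n - 3" if "v < n" for v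
  proof -
    let ?N = "{v, if Suc v = n then 0 else Suc v, if v = 0 then n - 1 else v - 1}"
    have "{w. (v, w) \<in> parcs (graph_complement (cycle_graph n))} =
        {..<n} - insert v {w. (v, w) \<in> parcs (cycle_graph n)}"
      using that by (auto simp: parcs_complement_cycle_iff)
    also have "\<dots> = {..<n} - ?N"
      using cycle_graph_neighbours[OF assms that] by simp
    also have "card \<dots> = n - card ?N"
      using assms that by (subst card_Diff_subset) auto
    \<comment> \<open>The two cycle neighbours of \<open>v\<close> differ from each other and from
      \<open>v\<close> because \<open>n \<ge> 3\<close>.\<close>
    also have "card ?N = 3"
      using assms that by (auto simp: card_insert_if)
    finally show ?thesis .
  qed
  then show ?thesis
    by (simp add: regular_graph_def out_degree_with_proj pverts_complement_cycle)
qed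

lemma chromatic_number_complement_cycle:
  assumes n: "n \<ge> 4"
  shows "chromatic_number (graph_complement (cycle_graph n)) = (n + 1) div 2"
  unfolding chromatic_number_def
proof (rule Least_equality)
  let ?G = "graph_complement (cycle_graph n)"
  \<comment> \<open>The classes of \<open>v div 2\<close> are the pairs \<open>2i, 2i + 1\<close>,
    with a last singleton if \<open>n\<close> is odd. Such pairs are cycle edges, hence non-adjacent
    in the complement.\<close>
  have adj: "(u, v) \<in> parcs (cycle_graph n)"
    if "u \<noteq> v" "u < n" "v < n" "u div 2 = v div 2" for u v
  proof -
    have "v = Suc u \<or> u = Suc v"
      using that(1,4) by linarith
    then show ?thesis
      using that(2,3) by (elim disjE) (simp_all add: cycle_graph_def)
  qed
  have "v div 2 < (n + 1) div 2" if "v < n" for v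
    using that by linarith
  then have "proper_coloring ?G ((n + 1) div 2) (\<lambda>v. v div 2)"
    unfolding proper_coloring_def
    by (auto simp only: pverts_complement_cycle parcs_complement_cycle_iff lessThan_iff dest: adj)
  then show "\<exists>c. proper_coloring ?G ((n + 1) div 2) c" by blast
next
  let ?G = "graph_complement (cycle_graph n)"
  fix k assume "\<exists>c. proper_coloring ?G k c"
  then obtain c where c: "proper_coloring ?G k c" by blast
  let ?C = "\<lambda>x. {v \<in> {..<n}. c v = x}"
  \<comment> \<open>A colour class is independent in the complement, hence a clique of the cycle. So
    \<open>k\<close> classes cover at most \<open>2 * k\<close> of the \<open>n\<close>
    vertices.\<close>
  have "card (?C x) \<le> 2" for x
  proof (rule cycle_graph_clique_card[OF n])
    fix i j assume "i \<in> ?C x" "j \<in> ?C x" "i \<noteq> j"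
    then show "(i, j) \<in> parcs (cycle_graph n)"
      using c parcs_complement_cycle_iff[of i j n] by (auto simp: proper_coloring_def)
  qed auto
  then have "(\<Sum>x<k. card (?C x)) \<le> 2 * k"
    using sum_mono[of "{..<k}" "\<lambda>x. card (?C x)" "\<lambda>_. 2"] by simp
  moreover have "card (\<Union>x<k. ?C x) \<le> (\<Sum>x<k. card (?C x))"
    by (rule card_UN_le) simp
  moreover have "(\<Union>x<k. ?C x) = {..<n}"
    using c by (auto simp: proper_coloring_def pverts_complement_cycle)
  ultimately have "n \<le> 2 * k" by simp
  then show "(n + 1) div 2 \<le> k" by simp
qed

theorem theorem3:
  fixes n :: nat
  assumes "n \<ge> 6"
  shows "extremal_r_chi_graph (n - 3) (nat \<lceil>real n / 2\<rceil>) (graph_complement (cycle_graph n)) \<and>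
    (\<forall>H :: 'a pair_pre_digraph.
       r_chi_graph (n - 3) (nat \<lceil>real n / 2\<rceil>) H \<longrightarrow> n \<le> graph_order H)"
proof -
  have "graph_order (graph_complement (cycle_graph n)) = n"
    by (simp add: graph_order_def pverts_complement_cycle)
  moreover have "r_chi_graph (n - 3) ((n + 1) div 2) (graph_complement (cycle_graph n))"
    using assms
    by (simp add: r_chi_graph_def pair_graph_complement_cycle regular_complement_cycle
        chromatic_number_complement_cycle)
  \<comment> \<open>The lower bound is polymorphic in the vertex type, so it serves both the
    comparison over \<open>nat\<close> inside extremality and the one over an arbitrary
    type.\<close>
  ultimately show ?thesis
    unfolding extremal_r_chi_graph_def nat_ceiling_half
    by (simp only:) (blast intro: graph_order_lower_bound[OF assms])
qed

end
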